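(* Let $\alpha,\zeta,\delta>0$ and $\gamma\in\mathbb{R}$, and let $F$ be the cumulative distribution function of the symmetric K-distribution with parameters $(\alpha,\zeta,\delta,\gamma)$, i.e. $F(x)=\int_{-\infty}^{x} f(t)\,dt$ with $$f(t)=\frac{\delta^{\frac{\alpha+\zeta}{2}}}{\Gamma(\alpha)\Gamma(\zeta)}\,|t-\gamma|^{\frac{\alpha+\zeta}{2}-1}K_{\alpha-\zeta}\left(2\sqrt{\delta|t-\gamma|}\right).$$ Then for all real $x$, $$F(x)=\frac12+\frac{\mathrm{sgn}(x-\gamma)\,\delta^{\frac{\alpha+\zeta}{2}}}{2\Gamma(\alpha)\Gamma(\zeta)}\,|x-\gamma|^{\frac{\alpha+\zeta}{2}}\;G_{1,3}^{2,1}\left(\delta|x-\gamma|\;\middle|\;\begin{array}{c}1-\frac{\alpha+\zeta}{2}\\ \frac{\alpha-\zeta}{2},\,-\frac{\alpha-\zeta}{2},\,-\frac{\alpha+\zeta}{2}\end{array}\right),$$ where for $x=\gamma$ the second term is understood as its limiting value $0$.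
   Context: $\Gamma$ is the Gamma function; $K_\nu$ is the modified Bessel function of the second kind of order $\nu$; $\mathrm{sgn}(x)=1$ for $x\ge 0$ and $-1$ for $x<0$. $G_{p,q}^{m,n}$ is the Meijer G-function: for $x>0$, $$G_{p,q}^{m,n}\left(x\;\middle|\;\begin{array}{c}a_1,\dots,a_p\\ b_1,\dots,b_q\end{array}\right)=\frac{1}{2\pi i}\int_L \frac{\prod_{j=1}^m\Gamma(b_j-s)\prod_{j=1}^n\Gamma(1-a_j+s)}{\prod_{j=m+1}^q\Gamma(1-b_j+s)\prod_{j=n+1}^p\Gamma(a_j-s)}\,x^s\,ds,$$ where empty products equal $1$ and $L$ runs from $-i\infty$ to $+i\infty$, with all poles of $\Gamma(b_j-s)$, $1\le j\le m$, on its right and all poles of $\Gamma(1-a_j+s)$, $1\le j\le n$, on its left. In the present case $L$ may be taken to be any vertical line $\mathrm{Re}\,s=c$ with $-\frac{\alpha+\zeta}{2}<c<-\frac{|\alpha-\zeta|}{2}$. *)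

theory Defs
  imports "HOL-Analysis.Analysis"
begin

text \<open>Modified Bessel function of the second kind of real order, for positive argument,
  through its standard integral representation.\<close>

definition bessel_K :: "real \<Rightarrow> real \<Rightarrow> real" where
  "bessel_K \<nu> x = (LINT t:{0..}|lborel. exp (- x * cosh t) * cosh (\<nu> * t))"

text \<open>Parameter lists are 0-indexed: \<open>a ! j\<close> and \<open>b ! j\<close> are the usual
  \<open>a\<close> and \<open>b\<close> with index \<open>j + 1\<close>, and \<open>p = length a\<close>, \<open>q = length b\<close>.\<close>

definition meijer_integrand ::
    "nat \<Rightarrow> nat \<Rightarrow> complex list \<Rightarrow> complex list \<Rightarrow> real \<Rightarrow> complex \<Rightarrow> complex" where
  "meijer_integrand m n a b x s =
     ((\<Prod>j<m. Gamma (b ! j - s)) * (\<Prod>j<n. Gamma (1 - a ! j + s))) /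
     ((\<Prod>j=m..<length b. Gamma (1 - b ! j + s)) * (\<Prod>j=n..<length a. Gamma (a ! j - s)))
     * complex_of_real x powr s"

text \<open>The vertical line through \<open>c\<close> separates the poles. The poles of \<^const>\<open>Gamma\<close> are the
  non-positive integers.\<close>

definition separating_line ::
    "nat \<Rightarrow> nat \<Rightarrow> complex list \<Rightarrow> complex list \<Rightarrow> real \<Rightarrow> bool" where
  "separating_line m n a b c \<longleftrightarrow>
     (\<forall>j<m. \<forall>s. b ! j - s \<in> \<int>\<^sub>\<le>\<^sub>0 \<longrightarrow> c < Re s) \<and>
     (\<forall>j<n. \<forall>s. 1 - a ! j + s \<in> \<int>\<^sub>\<le>\<^sub>0 \<longrightarrow> Re s < c)"

text \<open>The Meijer G-function for parameters whose poles can be separated by a vertical line: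
  the common value of the Mellin-Barnes integrals over all such lines, traversed upwards as
  \<open>s = c + i t\<close>, so that \<open>ds = i dt\<close>.\<close>

definition meijer_G ::
    "nat \<Rightarrow> nat \<Rightarrow> complex list \<Rightarrow> complex list \<Rightarrow> real \<Rightarrow> complex" where
  "meijer_G m n a b x =
     (THE w. \<forall>c. separating_line m n a b c \<longrightarrow>
        w = 1 / (2 * complex_of_real pi * \<i>) *
            (LINT t|lborel. meijer_integrand m n a b x (Complex c t) * \<i>))"

lemma separating_line_K_iff:
  fixes \<alpha> \<zeta> c :: real
  shows "separating_line 2 1 [1 - complex_of_real ((\<alpha> + \<zeta>) / 2)]
           [complex_of_real ((\<alpha> - \<zeta>) / 2), - complex_of_real ((\<alpha> - \<zeta>) / 2),
            - complex_of_real ((\<alpha> + \<zeta>) / 2)] c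
         \<longleftrightarrow> - ((\<alpha> + \<zeta>) / 2) < c \<and> c < - (\<bar>\<alpha> - \<zeta>\<bar> / 2)"
proof -
  have right: "(\<forall>s. complex_of_real u - s \<in> \<int>\<^sub>\<le>\<^sub>0 \<longrightarrow> c < Re s) \<longleftrightarrow> c < u" for u
  proof
    assume "\<forall>s. complex_of_real u - s \<in> \<int>\<^sub>\<le>\<^sub>0 \<longrightarrow> c < Re s"
    from this[rule_format, of "of_real u"] show "c < u" by simp
  next
    assume "c < u"
    show "\<forall>s. complex_of_real u - s \<in> \<int>\<^sub>\<le>\<^sub>0 \<longrightarrow> c < Re s"
    proof (intro allI impI)
      fix s assume "complex_of_real u - s \<in> \<int>\<^sub>\<le>\<^sub>0"
      then obtain k where "complex_of_real u - s = - of_nat k" by (auto elim: nonpos_Ints_cases')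
      from arg_cong[OF this, of Re] \<open>c < u\<close> show "c < Re s" by simp
    qed
  qed
  have left: "(\<forall>s. complex_of_real u + s \<in> \<int>\<^sub>\<le>\<^sub>0 \<longrightarrow> Re s < c) \<longleftrightarrow> - u < c" for u
  proof
    assume "\<forall>s. complex_of_real u + s \<in> \<int>\<^sub>\<le>\<^sub>0 \<longrightarrow> Re s < c"
    from this[rule_format, of "- of_real u"] show "- u < c" by simp
  next
    assume "- u < c"
    show "\<forall>s. complex_of_real u + s \<in> \<int>\<^sub>\<le>\<^sub>0 \<longrightarrow> Re s < c"
    proof (intro allI impI)
      fix s assume "complex_of_real u + s \<in> \<int>\<^sub>\<le>\<^sub>0"
      then obtain k where "complex_of_real u + s = - of_nat k" by (auto elim: nonpos_Ints_cases')
      from arg_cong[OF this, of Re] \<open>- u < c\<close> show "Re s < c" by simp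
    qed
  qed
  have "c < - (\<bar>\<alpha> - \<zeta>\<bar> / 2) \<longleftrightarrow> c < (\<alpha> - \<zeta>) / 2 \<and> c < - ((\<alpha> - \<zeta>) / 2)"
    by (cases "\<alpha> \<le> \<zeta>") (auto simp: field_simps)
  then show ?thesis
    using right[of "(\<alpha> - \<zeta>) / 2"] right[of "- ((\<alpha> - \<zeta>) / 2)"] left[of "(\<alpha> + \<zeta>) / 2"]
    unfolding separating_line_def numeral_2_eq_2 One_nat_def All_less_Suc by (simp add: conj_ac)
qed

definition K_dist_pdf :: "real \<Rightarrow> real \<Rightarrow> real \<Rightarrow> real \<Rightarrow> real \<Rightarrow> real" where
  "K_dist_pdf \<alpha> \<zeta> \<delta> \<gamma> t =
     \<delta> powr ((\<alpha> + \<zeta>) / 2) / (Gamma \<alpha> * Gamma \<zeta>) *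
     \<bar>t - \<gamma>\<bar> powr ((\<alpha> + \<zeta>) / 2 - 1) * bessel_K (\<alpha> - \<zeta>) (2 * sqrt (\<delta> * \<bar>t - \<gamma>\<bar>))"

definition K_dist_cdf :: "real \<Rightarrow> real \<Rightarrow> real \<Rightarrow> real \<Rightarrow> real \<Rightarrow> real" where
  "K_dist_cdf \<alpha> \<zeta> \<delta> \<gamma> x = (LINT t:{..x}|lborel. K_dist_pdf \<alpha> \<zeta> \<delta> \<gamma> t)"

text \<open>Unlike \<^const>\<open>sgn\<close>, this takes the value 1 at 0.\<close>

definition sgn_right :: "real \<Rightarrow> real" where
  "sgn_right x = (if x \<ge> 0 then 1 else - 1)"

end

theory Submission
  imports Defs "HOL-Probability.Probability"
begin

text \<open>With \<open>\<sigma> = (\<alpha> + \<zeta>) / 2\<close>, the Meijer integrand at \<open>s = w - \<sigma>\<close> collapses to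
  \<open>x\<^sup>-\<^sup>\<sigma> \<Gamma>(\<alpha> - w) \<Gamma>(\<zeta> - w) / w * x\<^sup>w\<close>. In the variable \<open>y = ln u\<close>, the function
  \<open>exp (\<sigma> y) * 2 K (2 exp (y / 2))\<close> of order \<open>\<alpha> - \<zeta>\<close> is the convolution of the two log-gamma
  densities \<open>exp (\<alpha> y - exp y)\<close> and \<open>exp (\<zeta> y - exp y)\<close>, so its Laplace transform is
  \<open>\<Gamma>(\<alpha> - w) \<Gamma>(\<zeta> - w)\<close>; integrating up to \<open>v\<close> is convolution with a step function and contributes the
  factor \<open>1 / w\<close>. The Mellin-Barnes integral is therefore a Fourier inversion integral, which is
  evaluated by means of Levy's inversion theorem, without contour integration. Its absolute
  convergence already follows from \<open>\<bar>\<Gamma>(p + i t)\<bar> \<le> \<Gamma>(p + 1) / \<bar>p + i t\<bar>\<close>.\<close>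

subsection \<open>Logarithmic substitution and convolution\<close>

text \<open>The change of variables theorem concerns absolute integrability for the completed
  measure; measurability of \<open>f\<close> brings it back to \<open>lborel\<close>. Since
  integrability is an equivalence, the equation of integrals can be stated unconditionally.\<close>

lemma lborel_exp_substitution:
  fixes f :: "real \<Rightarrow> 'a::euclidean_space"
  assumes [measurable]: "f \<in> borel_measurable borel"
  shows set_integrable_exp_substitution_iff:
      "set_integrable lborel {0<..} f \<longleftrightarrow> integrable lborel (\<lambda>y. exp y *\<^sub>R f (exp y))"
    and set_integral_exp_substitution:
      "(LINT u:{0<..}|lborel. f u) = (LINT y|lborel. exp y *\<^sub>R f (exp y))"
proof -
  have img: "exp ` (UNIV :: real set) = {0<..}"
    by (auto simp: image_iff intro: exp_ln[symmetric])
  have subst: "(\<lambda>y. exp y *\<^sub>R f (exp y)) absolutely_integrable_on UNIV \<and>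
        integral UNIV (\<lambda>y. exp y *\<^sub>R f (exp y)) = b
      \<longleftrightarrow> f absolutely_integrable_on {0<..} \<and> integral {0<..} f = b" for b
    using has_absolute_integral_change_of_variables_real[of UNIV exp exp f b]
    by (simp add: img inj_on_def DERIV_exp has_field_derivative_at_within)
  have L: "f absolutely_integrable_on {0<..} \<longleftrightarrow> set_integrable lborel {0<..} f"
    unfolding set_integrable_def by (rule integrable_completion) measurable
  have R: "(\<lambda>y. exp y *\<^sub>R f (exp y)) absolutely_integrable_on UNIV
      \<longleftrightarrow> integrable lborel (\<lambda>y. exp y *\<^sub>R f (exp y))"
    unfolding set_integrable_def by (subst integrable_completion) auto
  show iff: "set_integrable lborel {0<..} f \<longleftrightarrow> integrable lborel (\<lambda>y. exp y *\<^sub>R f (exp y))"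
    using subst L R by blast
  show "(LINT u:{0<..}|lborel. f u) = (LINT y|lborel. exp y *\<^sub>R f (exp y))"
  proof (cases "set_integrable lborel {0<..} f")
    case True
    then have "(LINT u:{0<..}|lborel. f u) = integral {0<..} f"
      by (rule set_borel_integral_eq_integral)
    also have "\<dots> = integral UNIV (\<lambda>y. exp y *\<^sub>R f (exp y))"
      using subst[of "integral {0<..} f"] True L by simp
    also have "\<dots> = (LINT y|lborel. exp y *\<^sub>R f (exp y))"
      using iff True by (simp add: integral_lborel)
    finally show ?thesis .
  next
    \<comment> \<open>Neither side is integrable here, so both integrals have the default value
      0.\<close>
    case False
    then show ?thesis
      using iff unfolding set_integrable_def set_lebesgue_integral_def
      by (simp add: not_integrable_integral_eq)
  qed
qed

text \<open>Euler's integral under \<open>t = exp p\<close>; the factor \<open>exp p\<close> of the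
  substitution turns the exponent \<open>z - 1\<close> into \<open>z\<close>.\<close>

lemma Gamma_log_integral:
  assumes "Re z > 0"
  shows integrable_Gamma_log: "integrable lborel (\<lambda>p. exp (z * of_real p - of_real (exp p)))"
    and Gamma_eq_log_integral: "(LINT p|lborel. exp (z * of_real p - of_real (exp p))) = Gamma z"
proof -
  \<comment> \<open>Writing the power through the real \<open>ln\<close> makes Borel measurability
    immediate; only positive \<open>t\<close> matter.\<close>
  let ?f = "\<lambda>t. exp ((z - 1) * of_real (ln t)) / complex_of_real (exp t)"
  have meas: "?f \<in> borel_measurable borel"
    by (intro borel_measurable_divide borel_measurable_of_real) simp_all
  have powr: "complex_of_real t powr (z - 1) / of_real (exp t) = ?f t" if "t \<in> {0<..}" for t
    using that by (simp add: powr_def Ln_of_real)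
  have eq: "exp p *\<^sub>R ?f (exp p) = exp (z * of_real p - of_real (exp p))" for p :: real
    by (simp add: scaleR_conv_of_real exp_diff exp_of_real[symmetric] algebra_simps)
  have "?f absolutely_integrable_on {0<..}"
    using absolutely_integrable_Gamma_integral'[OF assms]
    by (subst (asm) set_integrable_cong[OF refl refl powr]) auto
  then have int: "set_integrable lborel {0<..} ?f"
    using meas unfolding set_integrable_def by (subst (asm) integrable_completion) auto
  then show "integrable lborel (\<lambda>p. exp (z * of_real p - of_real (exp p)))"
    using set_integrable_exp_substitution_iff[OF meas] by (simp only: eq)
  have "(LINT p|lborel. exp (z * of_real p - of_real (exp p))) = integral {0<..} ?f"
    using set_integral_exp_substitution[OF meas] set_borel_integral_eq_integral(2)[OF int]
    by (simp only: eq)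
  also have "\<dots> = Gamma z"
    using has_integral_eq[OF powr Gamma_integral_complex'[OF assms]] by (rule integral_unique)
  finally show "(LINT p|lborel. exp (z * of_real p - of_real (exp p))) = Gamma z" .
qed

lemma Gamma_log_integral_real:
  fixes a :: real
  assumes "a > 0"
  shows integrable_Gamma_log_real: "integrable lborel (\<lambda>p. exp (a * p - exp p))"
    and Gamma_eq_log_integral_real: "(LINT p|lborel. exp (a * p - exp p)) = Gamma a"
proof -
  have eq: "exp (complex_of_real a * of_real p - of_real (exp p)) = of_real (exp (a * p - exp p))" for p
    by (simp add: exp_of_real[symmetric])
  show "integrable lborel (\<lambda>p. exp (a * p - exp p))"
    using integrable_Gamma_log[of "of_real a"] assms
    by (simp only: eq complex_of_real_integrable_eq Re_complex_of_real)
  have "complex_of_real (LINT p|lborel. exp (a * p - exp p)) = of_real (Gamma a)"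
    using Gamma_eq_log_integral[of "of_real a"] assms
    by (simp only: eq integral_complex_of_real Re_complex_of_real Gamma_complex_of_real)
  then show "(LINT p|lborel. exp (a * p - exp p)) = Gamma a"
    by (simp only: of_real_eq_iff)
qed

text \<open>Fubini, with the integral over \<open>x\<close> taken first: translation invariance
  makes the integral of \<open>g (x - y)\<close> independent of \<open>y\<close>. The general value
  type covers both real densities and complex exponential tilts.\<close>

lemma convolution_lborel:
  fixes f g :: "real \<Rightarrow> 'a::{real_normed_field, banach, second_countable_topology}"
  assumes f: "integrable lborel f" and g: "integrable lborel g"
  shows integrable_convolution_lborel: "integrable lborel (\<lambda>x. LINT y|lborel. f y * g (x - y))"
    and integral_convolution_lborel:
      "(LINT x|lborel. LINT y|lborel. f y * g (x - y)) = (LINT y|lborel. f y) * (LINT y|lborel. g y)"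
proof -
  have [measurable]: "f \<in> borel_measurable borel" "g \<in> borel_measurable borel"
    using f g by auto
  have shift: "integrable lborel (\<lambda>x. g (x - y))" "(LINT x|lborel. g (x - y)) = (LINT x|lborel. g x)" for y
    using lborel_integrable_real_affine[OF g, of 1 "- y"] lborel_integral_real_affine[of 1 g "- y"]
    by (simp_all add: algebra_simps)
  have shift_norm: "(LINT x|lborel. norm (g (x - y))) = (LINT x|lborel. norm (g x))" for y
    using lborel_integral_real_affine[of 1 "\<lambda>x. norm (g x)" "- y"] by (simp add: algebra_simps)
  let ?F = "\<lambda>(y, x). f y * g (x - y)"
  have int: "integrable (lborel \<Otimes>\<^sub>M lborel) ?F"
  proof (rule lborel_pair.Fubini_integrable)
    show "integrable lborel (\<lambda>y. LINT x|lborel. norm (?F (y, x)))"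
      using f by (simp add: norm_mult shift_norm)
    show "AE y in lborel. integrable lborel (\<lambda>x. ?F (y, x))"
      using shift by simp
  qed measurable
  show "integrable lborel (\<lambda>x. LINT y|lborel. f y * g (x - y))"
    using lborel_pair.integrable_fst'[OF lborel_pair.integrable_product_swap[OF int]] by simp
  have "(LINT x|lborel. LINT y|lborel. f y * g (x - y)) = (LINT y|lborel. LINT x|lborel. f y * g (x - y))"
    using int by (intro lborel_pair.Fubini_integral)  simp
  also have "\<dots> = (LINT y|lborel. f y) * (LINT y|lborel. g y)"
    by (simp add: shift)
  finally show "(LINT x|lborel. LINT y|lborel. f y * g (x - y)) = (LINT y|lborel. f y) * (LINT y|lborel. g y)" .
qed

subsection \<open>Fourier inversion for densities\<close>

text \<open>The fundamental theorem of calculus at the left end of \<open>{a..a + 1}\<close>, read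
  along a positive null sequence. It recovers a continuous density from its interval masses.\<close>

lemma integral_segment_average_tendsto:
  fixes h :: "real \<Rightarrow> real"
  assumes h: "continuous_on UNIV h"
  shows "(\<lambda>n. integral {a..a + inverse (real (Suc n))} h / inverse (real (Suc n))) \<longlonglongrightarrow> h a"
proof -
  have "((\<lambda>u. integral {a..u} h) has_real_derivative h a) (at a within {a..a + 1})"
    using h by (intro integral_has_real_derivative) (auto intro: continuous_on_subset)
  then have "((\<lambda>u. (integral {a..u} h - integral {a..a} h) / (u - a)) \<longlongrightarrow> h a) (at a within {a..a + 1})"
    by (simp add: has_field_derivative_iff)
  moreover have "filterlim (\<lambda>n. a + inverse (real (Suc n))) (at a within {a..a + 1}) sequentially"
    unfolding filterlim_at
  proof
    show "\<forall>\<^sub>F n in sequentially. a + inverse (real (Suc n)) \<in> {a..a + 1} \<and> a + inverse (real (Suc n)) \<noteq> a"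
      by (auto intro!: always_eventually simp: field_simps)
    show "(\<lambda>n. a + inverse (real (Suc n))) \<longlonglongrightarrow> a"
      using LIMSEQ_inverse_real_of_nat_add by simp
  qed
  ultimately show ?thesis
    by (auto dest: filterlim_compose simp: o_def)
qed

text \<open>Levy's theorem expresses interval masses through \<open>\<phi>\<close>. Integrability of
  \<open>\<phi>\<close> allows dominated convergence twice: first to remove the truncation to
  \<open>(-T, T)\<close>, then to shrink the interval to the point \<open>a\<close>, where
  continuity of \<open>h\<close> identifies the limit of the averages.\<close>

lemma density_eq_inverse_char:
  fixes h :: "real \<Rightarrow> real"
  assumes h: "integrable lborel h" and nonneg: "\<And>y. h y \<ge> 0" and cont: "continuous_on UNIV h"
    and total: "(LINT y|lborel. h y) = 1"
  defines "\<phi> \<equiv> \<lambda>t. (CLINT y|lborel. h y * iexp (t * y))"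
  assumes \<phi>: "integrable lborel \<phi>"
  shows "complex_of_real (h a) = 1 / (2 * pi) * (CLINT t|lborel. iexp (- (t * a)) * \<phi> t)"
proof -
  define M where "M = density lborel (\<lambda>y. ennreal (h y))"
  have [measurable]: "h \<in> borel_measurable borel" using h by auto
  have "emeasure M (space M) = 1"
    using total h nonneg by (simp add: M_def emeasure_density nn_integral_eq_integral)
  then interpret prob_space M by (rule prob_spaceI)
  interpret real_distribution M
    by (intro real_distribution.intro prob_space_axioms) (simp add: real_distribution_axioms_def M_def)
  have char_eq: "char M = \<phi>"
    unfolding char_def \<phi>_def M_def
    by (intro ext, subst integral_density) (auto simp: nonneg scaleR_conv_of_real)
  \<comment> \<open>Levy's theorem measures half-open intervals; the missing endpoint is a Lebesgue
    null set.\<close>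
  have meas_Ioc: "measure M {u<..v} = integral {u..v} h" for u v
  proof -
    have "measure M {u<..v} = measure M {u..v}"
    proof -
      have "AE y in lborel. ennreal (h y) * indicator {u<..v} y = ennreal (h y) * indicator {u..v} y"
        using AE_lborel_singleton[of u] by eventually_elim (auto simp: indicator_def)
      then have "(\<integral>\<^sup>+ y. ennreal (h y) * indicator {u<..v} y \<partial>lborel) = (\<integral>\<^sup>+ y. ennreal (h y) * indicator {u..v} y \<partial>lborel)"
        by (rule nn_integral_cong_AE)
      then show ?thesis
        by (simp add: M_def measure_def emeasure_density)
    qed
    also have "\<dots> = (LINT y|lborel. h y * indicator {u..v} y)"
      using integral_density[of "indicator {u..v} :: real \<Rightarrow> real" lborel h] nonneg by (simp add: M_def)
    also have "\<dots> = (LINT y:{u..v}|lborel. h y)"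
      by (simp add: set_lebesgue_integral_def mult.commute)
    also have "\<dots> = integral {u..v} h"
      using integrable_mult_indicator[of "{u..v}" lborel h] h
      by (intro set_borel_integral_eq_integral) (simp add: set_integrable_def)
    finally show ?thesis .
  qed
  have atom: "measure M {u} = 0" for u
  proof -
    have "AE y in lborel. ennreal (h y) * indicator {u} y = 0"
      using AE_lborel_singleton[of u] by eventually_elim (auto simp: indicator_def)
    then have "(\<integral>\<^sup>+ y. ennreal (h y) * indicator {u} y \<partial>lborel) = 0"
      by (subst nn_integral_0_iff_AE) auto
    then show ?thesis
      by (simp add: M_def measure_def emeasure_density)
  qed
  \<comment> \<open>For \<open>u \<le> v\<close> and \<open>t \<noteq> 0\<close> this is the
    integral of \<open>iexp (- (t * y))\<close> over \<open>y\<close> in \<open>{u..v}\<close>,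
    hence bounded by \<open>v - u\<close>. At \<open>t = 0\<close> division by zero gives 0, a
    harmless value at a single point.\<close>
  define F where "F u v t = (iexp (- (t * u)) - iexp (- (t * v))) / (\<i> * complex_of_real t)" for u v t :: real
  have [measurable]: "F u v \<in> borel_measurable borel" for u v
    unfolding F_def[abs_def] by measurable
  have F_bound: "norm (F u v t) \<le> v - u" if "u \<le> v" for u v t
    using Levy_Inversion_aux2[of "- v" "- u" t] that by (cases "t = 0") (simp_all add: F_def)
  have inv: "of_real (integral {u..v} h) = 1 / (2 * pi) * (CLINT t|lborel. F u v t * \<phi> t)" if "u \<le> v" for u v
  proof -
    have "(\<lambda>T::nat. 1 / (2 * pi) * (CLBINT t=ereal (- real T)..ereal (real T). F u v t * \<phi> t)) \<longlonglongrightarrow> of_real (integral {u..v} h)"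
      using Levy_Inversion[OF that] atom by (simp add: char_eq meas_Ioc F_def)
    moreover have "(\<lambda>T::nat. 1 / (2 * pi) * (CLBINT t=ereal (- real T)..ereal (real T). F u v t * \<phi> t))
        \<longlonglongrightarrow> 1 / (2 * pi) * (CLINT t|lborel. F u v t * \<phi> t)"
    proof (rule tendsto_mult_left)
      have "(\<lambda>T::nat. CLINT t|lborel. indicator {- real T<..<real T} t *\<^sub>R (F u v t * \<phi> t))
          \<longlonglongrightarrow> (CLINT t|lborel. F u v t * \<phi> t)"
      proof (rule integral_dominated_convergence[where w = "\<lambda>t. (v - u) * norm (\<phi> t)"])
        show "AE t in lborel. (\<lambda>T::nat. indicator {- real T<..<real T} t *\<^sub>R (F u v t * \<phi> t))
          \<longlonglongrightarrow> F u v t * \<phi> t"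
        proof (rule AE_I2)
          fix t :: real
          obtain N :: nat where "\<bar>t\<bar> < real N" using reals_Archimedean2 by blast
          then have "\<forall>\<^sub>F T in sequentially. indicator {- real T<..<real T} t *\<^sub>R (F u v t * \<phi> t) = F u v t * \<phi> t"
            by (intro eventually_sequentiallyI[of N]) (auto simp: indicator_def)
          then show "(\<lambda>T::nat. indicator {- real T<..<real T} t *\<^sub>R (F u v t * \<phi> t)) \<longlonglongrightarrow> F u v t * \<phi> t"
            by (rule tendsto_eventually)
        qed
        show "AE t in lborel. norm (indicator {- real T<..<real T} t *\<^sub>R (F u v t * \<phi> t)) \<le> (v - u) * norm (\<phi> t)" for T :: nat
          using F_bound[OF that] that
          by (intro AE_I2) (auto simp: norm_mult indicator_def simp del: norm_divide intro: mult_right_mono)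
      qed (use \<phi> in auto)
      then show "(\<lambda>T::nat. CLBINT t=ereal (- real T)..ereal (real T). F u v t * \<phi> t) \<longlonglongrightarrow> (CLINT t|lborel. F u v t * \<phi> t)"
        by (simp add: interval_lebesgue_integral_def set_lebesgue_integral_def)
    qed
    ultimately show ?thesis by (rule LIMSEQ_unique)
  qed
  define e where "e n = inverse (real (Suc n))" for n
  have e_pos: "e n > 0" for n by (simp add: e_def)
  have e_lim: "e \<longlonglongrightarrow> 0" unfolding e_def by (rule LIMSEQ_inverse_real_of_nat)
  have "(\<lambda>n. of_real (integral {a..a + e n} h / e n)) \<longlonglongrightarrow> complex_of_real (h a)"
    unfolding e_def by (intro tendsto_of_real integral_segment_average_tendsto cont)
  moreover have "complex_of_real (integral {a..a + e n} h / e n) =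
      1 / (2 * pi) * (CLINT t|lborel. F a (a + e n) t / e n * \<phi> t)" for n
  proof -
    have "complex_of_real (integral {a..a + e n} h / e n) =
        1 / (2 * pi) * ((CLINT t|lborel. F a (a + e n) t * \<phi> t) / e n)"
      using inv[of a "a + e n"] e_pos[of n] by simp
    then show ?thesis
      by (simp add: mult.commute[of _ "\<phi> _"])
  qed
  moreover have "(\<lambda>n. 1 / (2 * pi) * (CLINT t|lborel. F a (a + e n) t / e n * \<phi> t)) \<longlonglongrightarrow>
      1 / (2 * pi) * (CLINT t|lborel. iexp (- (t * a)) * \<phi> t)"
  proof (rule tendsto_mult_left, rule integral_dominated_convergence[where w = "\<lambda>t. norm (\<phi> t)"])
    show "AE t in lborel. norm (F a (a + e n) t / e n * \<phi> t) \<le> norm (\<phi> t)" for n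
    proof (rule AE_I2)
      fix t
      have "norm (F a (a + e n) t / e n) \<le> 1"
        using F_bound[of a "a + e n" t] e_pos[of n] by (simp add: norm_divide field_simps)
      then show "norm (F a (a + e n) t / e n * \<phi> t) \<le> norm (\<phi> t)"
        by (simp only: norm_mult mult_left_le_one_le norm_ge_zero)
    qed
    have lim: "(\<lambda>n. F a (a + e n) t / e n) \<longlonglongrightarrow> iexp (- (t * a))" if "t \<noteq> 0" for t
    proof -
      \<comment> \<open>\<open>F a (a + e n) t / e n\<close> is the difference quotient of
        \<open>?G\<close> at \<open>a\<close> with increment \<open>e n\<close>.\<close>
      let ?G = "\<lambda>z. - exp (\<i> * (- of_real t * z)) / (\<i> * of_real t)"
      have "(?G has_field_derivative iexp (- (t * a))) (at (of_real a))"
        using that by (auto intro!: derivative_eq_intros simp: field_simps)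
      then have "((\<lambda>z. (?G (of_real a + z) - ?G (of_real a)) / z) \<longlongrightarrow> iexp (- (t * a))) (at 0)"
        by (rule DERIV_D)
      moreover have "filterlim (\<lambda>n. complex_of_real (e n)) (at 0) sequentially"
        unfolding filterlim_at using e_pos e_lim
        by (auto intro!: tendsto_eq_intros always_eventually simp: less_imp_neq[symmetric])
      ultimately have "(\<lambda>n. (?G (of_real a + of_real (e n)) - ?G (of_real a)) / of_real (e n)) \<longlonglongrightarrow> iexp (- (t * a))"
        by (rule filterlim_compose)
      then show ?thesis
        by (simp add: F_def diff_divide_distrib algebra_simps)
    qed
    show "AE t in lborel. (\<lambda>n. F a (a + e n) t / e n * \<phi> t) \<longlonglongrightarrow> iexp (- (t * a)) * \<phi> t"
      using AE_lborel_singleton[of 0]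
      by eventually_elim (intro tendsto_mult tendsto_const lim)
  qed (use \<phi> in auto)
  ultimately show ?thesis by (auto intro: LIMSEQ_unique)
qed

subsection \<open>Integrals of even functions\<close>

lemma set_integral_reflect_even:
  fixes q :: "real \<Rightarrow> real"
  assumes even: "\<And>s. q (- s) = q s"
  shows "(LINT s:{..r}|lborel. q s) = (LINT s:{- r..}|lborel. q s)"
  unfolding set_lebesgue_integral_def
  by (subst lborel_integral_real_affine[of "-1" _ 0]) 
     (auto simp: even indicator_def intro!: Bochner_Integration.integral_cong)

text \<open>For \<open>r \<ge> 0\<close> the ray is the negative half line plus
  \<open>{0<..<r}\<close>. For \<open>r < 0\<close> reflection turns it into \<open>{- r..}\<close>,
  the positive half line minus \<open>{0<..<- r}\<close>. \<open>sgn_right\<close> merges both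
  cases.\<close>

lemma set_integral_even_atMost:
  fixes q :: "real \<Rightarrow> real"
  assumes q: "integrable lborel q" and even: "\<And>s. q (- s) = q s"
  shows "(LINT s:{..r}|lborel. q s) =
    (LINT s:{0<..}|lborel. q s) + sgn_right r * (LINT s:{0<..<\<bar>r\<bar>}|lborel. q s)"
proof -
  have [measurable]: "q \<in> borel_measurable borel" using q by auto
  have si: "set_integrable lborel A q" if "A \<in> sets borel" for A
    unfolding set_integrable_def using q that by (intro integrable_mult_indicator) auto
  have closed: "(LINT s:{u..}|lborel. q s) = (LINT s:{u<..}|lborel. q s)" for u
    unfolding set_lebesgue_integral_def
    using AE_lborel_singleton[of u]
    by (intro integral_cong_AE) (auto elim!: eventually_mono simp: indicator_def)
  have split: "(LINT s:{0<..}|lborel. q s) = (LINT s:{0<..<u}|lborel. q s) + (LINT s:{u..}|lborel. q s)"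
    if "u \<ge> 0" for u
  \<comment> \<open>For \<open>u = 0\<close> the union \<open>{0<..<u} \<union> {u..}\<close> would
    contain the extra point 0, so that case uses \<open>closed\<close> instead.\<close>
  proof (cases "u = 0")
    case False
    then have "{0<..} = {0<..<u} \<union> {u..}" using that by auto
    then have "(LINT s:{0<..}|lborel. q s) = (LINT s:{0<..<u} \<union> {u..}|lborel. q s)" by simp
    also have "\<dots> = (LINT s:{0<..<u}|lborel. q s) + (LINT s:{u..}|lborel. q s)"
      by (rule set_integral_Un) (auto intro!: si)
    finally show ?thesis .
  next
    case True
    then show ?thesis using closed[of 0] by (simp add: set_lebesgue_integral_def)
  qed
  have split': "(LINT s:{..r}|lborel. q s) = (LINT s:{..0}|lborel. q s) + (LINT s:{0<..<r}|lborel. q s)" if "r \<ge> 0"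
  proof -
    have "(LINT s:{..r}|lborel. q s) = (LINT s:{..0} \<union> {0<..<r}|lborel. q s)"
      unfolding set_lebesgue_integral_def
      using AE_lborel_singleton[of r] that
      by (intro integral_cong_AE) (auto elim!: eventually_mono simp: indicator_def)
    also have "\<dots> = (LINT s:{..0}|lborel. q s) + (LINT s:{0<..<r}|lborel. q s)"
      by (rule set_integral_Un) (auto intro!: si)
    finally show ?thesis .
  qed
  show ?thesis
  proof (cases "r \<ge> 0")
    case True
    then show ?thesis
      using split' set_integral_reflect_even[of q 0] closed[of 0] even by (simp add: sgn_right_def)
  next
    case False
    then show ?thesis
      using split[of "- r"] set_integral_reflect_even[of q r] even by (simp add: sgn_right_def)
  qed
qed

lemma integral_even:
  fixes q :: "real \<Rightarrow> real"
  assumes q: "integrable lborel q" and even: "\<And>s. q (- s) = q s"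
  shows "(LINT s|lborel. q s) = 2 * (LINT s:{0..}|lborel. q s)"
proof -
  have si: "set_integrable lborel A q" if "A \<in> sets borel" for A
    unfolding set_integrable_def using q that by (intro integrable_mult_indicator) auto
  have "(LINT s|lborel. q s) = (LINT s:{..0} \<union> {0<..}|lborel. q s)"
    unfolding set_lebesgue_integral_def by (intro Bochner_Integration.integral_cong) (auto simp: indicator_def)
  also have "\<dots> = (LINT s:{..0}|lborel. q s) + (LINT s:{0<..}|lborel. q s)"
    by (rule set_integral_Un) (auto intro!: si)
  \<comment> \<open>At \<open>r = 0\<close> the correction term runs over the empty
    interval.\<close>
  also have "(LINT s:{0<..}|lborel. q s) = (LINT s:{..0}|lborel. q s)"
    using set_integral_even_atMost[OF q even, of 0] by (simp add: set_lebesgue_integral_def)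
  finally show ?thesis
    using set_integral_reflect_even[of q 0] even by simp
qed

subsection \<open>Log-gamma convolutions\<close>

text \<open>The substitution \<open>p = y / 2 + t\<close> turns this convolution into a Bessel integral, whereas its
  two-sided Laplace transform is a product of two Gamma functions.\<close>

definition loggamma_conv :: "real \<Rightarrow> real \<Rightarrow> real \<Rightarrow> real" where
  "loggamma_conv a b y = (LINT p|lborel. exp (a * p - exp p) * exp (b * (y - p) - exp (y - p)))"

text \<open>Not normalised: for positive parameters the limit at infinity is
  \<open>Gamma a * Gamma b\<close>. The strict bound makes it the convolution with the indicator of
  \<open>{0<..}\<close>.\<close>

definition loggamma_conv_cdf :: "real \<Rightarrow> real \<Rightarrow> real \<Rightarrow> real" where
  "loggamma_conv_cdf a b v = (LINT y:{..<v}|lborel. loggamma_conv a b y)"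

text \<open>The bound is the maximum, attained at \<open>z = ln b\<close>; it follows from
  \<open>1 + u \<le> exp u\<close> at \<open>u = z - ln b\<close>.\<close>

lemma loggamma_density_le:
  fixes b z :: real
  assumes "b > 0"
  shows "exp (b * z - exp z) \<le> exp (b * ln b - b)"
proof -
  have "exp z = b * exp (z - ln b)"
    using assms by (simp add: exp_diff)
  also have "\<dots> \<ge> b * (1 + (z - ln b))"
    using assms by (intro mult_left_mono exp_ge_add_one_self) auto
  finally show ?thesis by (simp add: algebra_simps)
qed

text \<open>Bounding the second factor by its maximum leaves a multiple of the Gamma
  integrand.\<close>

lemma integrable_loggamma_conv_integrand:
  fixes a b y :: real
  assumes "a > 0" "b > 0"
  shows "integrable lborel (\<lambda>p. exp (a * p - exp p) * exp (b * (y - p) - exp (y - p)))"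
proof (rule Bochner_Integration.integrable_bound)
  show "integrable lborel (\<lambda>p. exp (a * p - exp p) * exp (b * ln b - b))"
    using integrable_Gamma_log_real[OF assms(1)] by simp
  show "AE p in lborel. norm (exp (a * p - exp p) * exp (b * (y - p) - exp (y - p)))
      \<le> norm (exp (a * p - exp p) * exp (b * ln b - b))"
    unfolding norm_mult real_norm_def abs_exp_cancel
    by (auto intro!: mult_left_mono loggamma_density_le assms simp del: exp_le_cancel_iff mult_le_cancel_left)
qed measurable

text \<open>Centring at \<open>y / 2\<close> turns \<open>exp p + exp (y - p)\<close> into
  \<open>2 * exp (y / 2) * cosh t\<close> and leaves the factor \<open>exp ((a - b) * t)\<close>.
  Its odd part integrates to 0, and its even part gives twice the half-line Bessel integral.\<close>

lemma loggamma_conv_eq_bessel_K: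
  assumes "a > 0" "b > 0"
  shows "loggamma_conv a b y = 2 * exp ((a + b) / 2 * y) * bessel_K (a - b) (2 * exp (y / 2))"
proof -
  let ?X = "2 * exp (y / 2)"
  define G where "G t = exp (- ?X * cosh t) * exp ((a - b) * t)" for t
  have shift: "exp (a * (y / 2 + t) - exp (y / 2 + t)) * exp (b * (y - (y / 2 + t)) - exp (y - (y / 2 + t)))
      = exp ((a + b) / 2 * y) * G t" for t
  proof -
    have "?X * cosh t = exp (y / 2 + t) + exp (y - (y / 2 + t))"
    proof -
      have "exp (y / 2 + t) = exp (y / 2) * exp t" "exp (y - (y / 2 + t)) = exp (y / 2) * exp (- t)"
        by (simp_all add: exp_add[symmetric])
      then show ?thesis by (simp add: cosh_field_def field_simps)
    qed
    then show ?thesis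
      by (simp add: G_def flip: exp_add) (simp add: field_simps)
  qed
  have "integrable lborel (\<lambda>t. exp ((a + b) / 2 * y) * G t)"
    using lborel_integrable_real_affine[OF integrable_loggamma_conv_integrand[OF assms, of y], of 1 "y / 2"]
    by (simp only: shift mult_1 one_neq_zero not_False_eq_True)
  then have G: "integrable lborel G" by simp
  have G': "integrable lborel (\<lambda>t. G (- t))"
    using lborel_integrable_real_affine[OF G, of "-1" 0] by simp
  have cosh_G: "exp (- ?X * cosh t) * cosh ((a - b) * t) = (G t + G (- t)) / 2" for t
    by (simp add: G_def cosh_field_def field_simps)
  have "loggamma_conv a b y = (LINT t|lborel. exp ((a + b) / 2 * y) * G t)"
    unfolding loggamma_conv_def
    by (subst lborel_integral_real_affine[of 1 _ "y / 2"]) (simp_all only: shift mult_1, simp_all)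
  also have "\<dots> = exp ((a + b) / 2 * y) * (LINT t|lborel. G t)" by simp
  also have "(LINT t|lborel. G t) = (LINT t|lborel. exp (- ?X * cosh t) * cosh ((a - b) * t))"
    unfolding cosh_G using G G' lborel_integral_real_affine[of "-1" G 0] by simp
  also have "\<dots> = 2 * bessel_K (a - b) ?X"
    unfolding bessel_K_def
  proof (rule integral_even)
    show "integrable lborel (\<lambda>t. exp (- ?X * cosh t) * cosh ((a - b) * t))"
      unfolding cosh_G using G G' by simp
  qed simp
  finally show ?thesis by simp
qed

lemma loggamma_conv_nonneg: "loggamma_conv a b y \<ge> 0"
  unfolding loggamma_conv_def by (rule integral_nonneg_AE) simp

lemma integrable_loggamma_conv:
  assumes "a > 0" "b > 0"
  shows "integrable lborel (loggamma_conv a b)"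
  unfolding loggamma_conv_def[abs_def]
  by (intro integrable_convolution_lborel integrable_Gamma_log_real assms)

lemma integral_loggamma_conv:
  assumes "a > 0" "b > 0"
  shows "(LINT y|lborel. loggamma_conv a b y) = Gamma a * Gamma b"
  unfolding loggamma_conv_def
  using integral_convolution_lborel[OF integrable_Gamma_log_real integrable_Gamma_log_real] assms
  by (simp add: Gamma_eq_log_integral_real)

lemma loggamma_conv_cdf_nonneg: "loggamma_conv_cdf a b v \<ge> 0"
  unfolding loggamma_conv_cdf_def set_lebesgue_integral_def
  by (rule integral_nonneg_AE) (simp add: loggamma_conv_nonneg)

text \<open>Dominated convergence: the indicators of \<open>{..<u n}\<close> converge at every point
  other than \<open>v\<close>. Continuity is a hypothesis of
  \<open>density_eq_inverse_char\<close>.\<close>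

lemma continuous_loggamma_conv_cdf:
  assumes "a > 0" "b > 0"
  shows "continuous_on UNIV (loggamma_conv_cdf a b)"
proof (rule continuous_at_imp_continuous_on, rule ballI, rule continuous_at_sequentiallyI)
  fix v and u :: "nat \<Rightarrow> real"
  assume u: "u \<longlonglongrightarrow> v"
  note int = integrable_loggamma_conv[OF assms]
  show "(\<lambda>n. loggamma_conv_cdf a b (u n)) \<longlonglongrightarrow> loggamma_conv_cdf a b v"
    unfolding loggamma_conv_cdf_def set_lebesgue_integral_def
  proof (rule integral_dominated_convergence[where w = "loggamma_conv a b"])
    show "AE y in lborel. (\<lambda>n. indicator {..<u n} y *\<^sub>R loggamma_conv a b y)
        \<longlonglongrightarrow> indicator {..<v} y *\<^sub>R loggamma_conv a b y"
      using AE_lborel_singleton[of v]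
    proof eventually_elim
      case (elim y)
      have "\<forall>\<^sub>F n in sequentially. (y < u n) = (y < v)"
        using elim order_tendstoD[OF u, of y] by (cases "y < v") (auto elim: eventually_mono)
      then show ?case
        by (intro tendsto_eventually) (auto elim!: eventually_mono simp: indicator_def)
    qed
    show "AE y in lborel. norm (indicator {..<u n} y *\<^sub>R loggamma_conv a b y) \<le> loggamma_conv a b y" for n
      by (simp add: loggamma_conv_nonneg indicator_def)
  qed (use int in auto)
qed

section \<open>Laplace transforms of the convolution and of its integral\<close>

text \<open>As \<open>exp (- w * y)\<close> is the product of \<open>exp (- w * p)\<close> and
  \<open>exp (- w * (y - p))\<close>, the tilt passes to the two factors and replaces
  \<open>a\<close> and \<open>b\<close> by \<open>a - w\<close> and \<open>b - w\<close>. In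
  \<open>u = exp y\<close> this is a Mellin transform.\<close>

lemma mellin_loggamma_conv:
  fixes w :: complex
  assumes "Re w < a" "Re w < b"
  shows integrable_mellin_loggamma_conv: "integrable lborel (\<lambda>y. exp (- w * of_real y) * of_real (loggamma_conv a b y))"
    and integral_mellin_loggamma_conv:
      "(LINT y|lborel. exp (- w * of_real y) * of_real (loggamma_conv a b y)) = Gamma (of_real a - w) * Gamma (of_real b - w)"
proof -
  let ?E = "\<lambda>z p. exp (z * complex_of_real p - of_real (exp p))"
  have eq: "exp (- w * of_real y) * of_real (loggamma_conv a b y) =
      (LINT p|lborel. ?E (of_real a - w) p * ?E (of_real b - w) (y - p))" for y
  proof -
    have "exp (- w * of_real y) * of_real (exp (a * p - exp p) * exp (b * (y - p) - exp (y - p))) =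
        ?E (of_real a - w) p * ?E (of_real b - w) (y - p)" for p
      by (simp add: exp_add[symmetric] flip: exp_of_real) (simp add: algebra_simps)
    then show ?thesis
      unfolding loggamma_conv_def integral_complex_of_real[symmetric] integral_mult_right_zero[symmetric]
      by simp
  qed
  have "Re (of_real a - w) > 0" "Re (of_real b - w) > 0" using assms by simp_all
  note E = this[THEN integrable_Gamma_log] this[THEN Gamma_eq_log_integral]
  show "integrable lborel (\<lambda>y. exp (- w * of_real y) * of_real (loggamma_conv a b y))"
    unfolding eq by (intro integrable_convolution_lborel E)
  show "(LINT y|lborel. exp (- w * of_real y) * of_real (loggamma_conv a b y)) = Gamma (of_real a - w) * Gamma (of_real b - w)"
    unfolding eq by (subst integral_convolution_lborel) (use E in auto)
qed

text \<open>The Laplace transform of the step function, which supplies the factor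
  \<open>1 / w\<close> for \<open>loggamma_conv_cdf\<close>.\<close>

lemma integral_exp_neg_complex:
  fixes w :: complex
  assumes "Re w > 0"
  shows set_integrable_exp_neg_complex: "set_integrable lborel {0<..} (\<lambda>r. exp (- w * of_real r))"
    and set_integral_exp_neg_complex: "(LINT r:{0<..}|lborel. exp (- w * of_real r)) = 1 / w"
proof -
  have "(\<lambda>r. exp (- Re w * r)) absolutely_integrable_on {0..}"
    using integrable_on_exp_minus_to_infinity[OF assms, of 0] by (intro nonnegative_absolutely_integrable_1) auto
  then have "set_integrable lborel {0..} (\<lambda>r. exp (- Re w * r))"
    unfolding set_integrable_def by (subst (asm) integrable_completion) auto
  then have real: "set_integrable lborel {0<..} (\<lambda>r. exp (- Re w * r))"
    by (rule set_integrable_subset) auto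
  show int: "set_integrable lborel {0<..} (\<lambda>r. exp (- w * of_real r))"
    unfolding set_integrable_def
    by (rule Bochner_Integration.integrable_bound[OF real[unfolded set_integrable_def]])
       (auto simp: indicator_def)
  let ?F = "\<lambda>r. - exp (- w * of_real r) / w"
  have w: "w \<noteq> 0" using assms by auto
  have "(LBINT r=ereal 0..\<infinity>. exp (- w * of_real r)) = 0 - ?F 0"
  proof (rule interval_integral_FTC_integrable[where F = ?F])
    show "(?F has_vector_derivative exp (- w * of_real r)) (at r)" for r
    proof -
      have "((\<lambda>z. - exp (- w * z) / w) has_field_derivative exp (- w * of_real r)) (at (of_real r))"
        using w by (auto intro!: derivative_eq_intros)
      then show ?thesis
        by (rule has_vector_derivative_real_field)
    qed
    show "set_integrable lborel (einterval (ereal 0) \<infinity>) (\<lambda>r. exp (- w * of_real r))"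
      unfolding einterval_eq by (rule int)
    have "isCont ?F 0"
      using w by (intro continuous_intros)
    then have "(?F \<longlongrightarrow> ?F 0) (at_right 0)"
      unfolding isCont_def by (rule tendsto_mono[OF at_le, rotated]) simp
    then show "((?F \<circ> real_of_ereal) \<longlongrightarrow> ?F 0) (at_right (ereal 0))"
      unfolding ereal_tendsto_simps .
    have "LIM r at_top. - (Re w * r) :> at_bot"
      unfolding filterlim_uminus_at_bot minus_minus
      by (rule filterlim_tendsto_pos_mult_at_top[OF tendsto_const assms filterlim_ident])
    then have "((\<lambda>r. exp (- (Re w * r)) / norm w) \<longlongrightarrow> 0 / norm w) at_top"
      using w by (intro tendsto_divide tendsto_const filterlim_compose[OF exp_at_bot]) auto
    then have "(?F \<longlongrightarrow> 0) at_top"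
      by (intro tendsto_norm_zero_cancel[of ?F]) (simp add: norm_divide)
    then show "((?F \<circ> real_of_ereal) \<longlongrightarrow> 0) (at_left \<infinity>)"
      unfolding ereal_tendsto_simps .
    show "isCont (\<lambda>r. exp (- w * of_real r)) r" for r
      by (intro continuous_intros)
  qed simp
  then show "(LINT r:{0<..}|lborel. exp (- w * of_real r)) = 1 / w"
    unfolding interval_lebesgue_integral_def einterval_eq by simp
qed

text \<open>Since \<open>y < v\<close> means \<open>v - y > 0\<close>, the tilted integral is the
  convolution of the tilted \<open>loggamma_conv\<close> with a tilted step. The step needs
  \<open>Re w > 0\<close>, the other factor \<open>Re w < a\<close> and
  \<open>Re w < b\<close>.\<close>

lemma mellin_loggamma_conv_cdf:
  fixes w :: complex
  assumes "a > 0" "b > 0" "0 < Re w" "Re w < a" "Re w < b"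
  shows integrable_mellin_loggamma_conv_cdf:
      "integrable lborel (\<lambda>v. exp (- w * of_real v) * of_real (loggamma_conv_cdf a b v))"
    and integral_mellin_loggamma_conv_cdf:
      "(LINT v|lborel. exp (- w * of_real v) * of_real (loggamma_conv_cdf a b v)) =
        Gamma (of_real a - w) * Gamma (of_real b - w) / w"
proof -
  let ?f = "\<lambda>y. exp (- w * of_real y) * complex_of_real (loggamma_conv a b y)"
  let ?g = "\<lambda>r. indicator {0<..} r *\<^sub>R exp (- w * complex_of_real r)"
  have eq: "exp (- w * of_real v) * of_real (loggamma_conv_cdf a b v) = (LINT y|lborel. ?f y * ?g (v - y))" for v
  proof -
    have "exp (- w * of_real v) * of_real (indicator {..<v} y *\<^sub>R loggamma_conv a b y) = ?f y * ?g (v - y)" for y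
      by (auto simp: indicator_def algebra_simps simp flip: exp_add)
    then show ?thesis
      unfolding loggamma_conv_cdf_def set_lebesgue_integral_def integral_complex_of_real[symmetric]
        integral_mult_right_zero[symmetric]
      by simp
  qed
  have f: "integrable lborel ?f" using assms by (intro integrable_mellin_loggamma_conv)
  have g: "integrable lborel ?g"
    using set_integrable_exp_neg_complex[of w] assms by (simp add: set_integrable_def)
  show "integrable lborel (\<lambda>v. exp (- w * of_real v) * of_real (loggamma_conv_cdf a b v))"
    unfolding eq by (rule integrable_convolution_lborel[OF f g])
  show "(LINT v|lborel. exp (- w * of_real v) * of_real (loggamma_conv_cdf a b v)) =
        Gamma (of_real a - w) * Gamma (of_real b - w) / w"
    unfolding eq integral_convolution_lborel[OF f g]
    using integral_mellin_loggamma_conv[of w a b] set_integral_exp_neg_complex[of w] assms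
    by (simp add: set_lebesgue_integral_def)
qed

section \<open>Decay of Gamma on vertical lines and Mellin-Barnes inversion\<close>

lemma norm_Gamma_le:
  assumes "Re z > 0"
  shows "norm (Gamma z) \<le> Gamma (Re z)"
proof -
  have "norm (LINT p|lborel. exp (z * of_real p - of_real (exp p))) \<le>
      (LINT p|lborel. norm (exp (z * of_real p - of_real (exp p))))"
    by (rule integral_norm_bound)
  also have "\<dots> = (LINT p|lborel. exp (Re z * p - exp p))"
    by simp
  finally show ?thesis
    using assms by (simp add: Gamma_eq_log_integral Gamma_eq_log_integral_real)
qed

text \<open>The functional equation gains one power of \<open>norm z\<close> over the bound of
  \<open>norm_Gamma_le\<close> at \<open>z + 1\<close>.\<close>

lemma norm_Gamma_vertical_le:
  assumes "p > 0"
  shows "norm (Gamma (Complex p t)) \<le> Gamma (p + 1) / (min 1 p * sqrt (1 + t\<^sup>2))"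
proof -
  let ?z = "Complex p t"
  have "?z \<notin> \<int>\<^sub>\<le>\<^sub>0" using assms by (auto elim!: nonpos_Ints_cases simp: complex_eq_iff)
  then have "norm (Gamma (?z + 1)) = norm ?z * norm (Gamma ?z)"
    by (simp add: Gamma_plus1 norm_mult)
  moreover have "norm (Gamma (?z + 1)) \<le> Gamma (p + 1)"
    using norm_Gamma_le[of "?z + 1"] assms by simp
  \<comment> \<open>The constant \<open>min 1 p\<close> compares
    \<open>p\<^sup>2 + t\<^sup>2\<close> with \<open>1 + t\<^sup>2\<close> for small and large
    \<open>p\<close> alike.\<close>
  moreover have bound: "min 1 p * sqrt (1 + t\<^sup>2) \<le> norm ?z"
  proof -
    have "(min 1 p)\<^sup>2 \<le> 1\<^sup>2" "(min 1 p)\<^sup>2 \<le> p\<^sup>2"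
      using assms by (intro power_mono; simp)+
    then have "(min 1 p)\<^sup>2 * 1 \<le> p\<^sup>2" "(min 1 p)\<^sup>2 * t\<^sup>2 \<le> 1 * t\<^sup>2"
      by (simp, intro mult_right_mono) auto
    then have "(min 1 p)\<^sup>2 * (1 + t\<^sup>2) \<le> p\<^sup>2 + t\<^sup>2"
      by (simp add: distrib_left)
    then have "sqrt ((min 1 p)\<^sup>2 * (1 + t\<^sup>2)) \<le> sqrt (p\<^sup>2 + t\<^sup>2)" by (rule real_sqrt_le_mono)
    then show ?thesis using assms by (simp add: real_sqrt_mult cmod_def)
  qed
  ultimately have "norm (Gamma ?z) * (min 1 p * sqrt (1 + t\<^sup>2)) \<le> Gamma (p + 1)"
    using mult_left_mono[OF bound norm_ge_zero[of "Gamma ?z"]]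
    by (simp only: mult.commute[of _ "norm (Gamma _)"])
  moreover have "0 < min 1 p * sqrt (1 + t\<^sup>2)"
    using assms by (intro mult_pos_pos) (auto simp: add_pos_nonneg)
  ultimately show ?thesis
    by (simp add: pos_le_divide_eq)
qed

text \<open>Each factor decays like \<open>1 / sqrt (1 + t\<^sup>2)\<close>, so two of them give the
  integrable majorant \<open>inverse (1 + t\<^sup>2)\<close>.\<close>

lemma integrable_Gamma_Gamma_vertical:
  assumes "p > 0" "q > 0"
  shows "integrable lborel (\<lambda>t. Gamma (Complex p t) * Gamma (Complex q t))"
proof (rule Bochner_Integration.integrable_bound)
  let ?C = "Gamma (p + 1) / min 1 p * (Gamma (q + 1) / min 1 q)"
  show "integrable lborel (\<lambda>t. ?C * inverse (1 + t\<^sup>2))"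
    using integrable_inverse_1_plus_square by (intro integrable_mult_right) (simp add: set_integrable_def)
  have cont: "continuous_on UNIV (\<lambda>t. Gamma (Complex r t))" if "r > 0" for r
  proof (rule continuous_on_compose2[OF continuous_on_Gamma[of "{z. Re z > 0}"]])
    show "{z. Re z > 0} \<inter> \<int>\<^sub>\<le>\<^sub>0 = {}" by (auto elim!: nonpos_Ints_cases)
    show "continuous_on UNIV (Complex r)" unfolding Complex_eq[abs_def] by (intro continuous_intros)
  qed (use that in auto)
  show "(\<lambda>t. Gamma (Complex p t) * Gamma (Complex q t)) \<in> borel_measurable lborel"
    unfolding measurable_lborel2
    by (intro borel_measurable_continuous_onI continuous_on_mult cont assms)
  show "AE t in lborel. norm (Gamma (Complex p t) * Gamma (Complex q t)) \<le> norm (?C * inverse (1 + t\<^sup>2))"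
  proof (rule AE_I2)
    fix t :: real
    have "norm (Gamma (Complex p t) * Gamma (Complex q t)) \<le>
        Gamma (p + 1) / (min 1 p * sqrt (1 + t\<^sup>2)) * (Gamma (q + 1) / (min 1 q * sqrt (1 + t\<^sup>2)))"
      unfolding norm_mult
      by (intro mult_mono norm_Gamma_vertical_le assms order_trans[OF norm_ge_zero norm_Gamma_vertical_le]) auto
    also have "\<dots> = ?C * inverse (sqrt (1 + t\<^sup>2) * sqrt (1 + t\<^sup>2))"
      by (simp only: divide_inverse inverse_mult_distrib mult_ac)
    also have "\<dots> = ?C * inverse (1 + t\<^sup>2)"
      by simp
    also have "\<dots> \<le> norm (?C * inverse (1 + t\<^sup>2))"
      unfolding real_norm_def by (rule abs_ge_self)
    finally show "norm (Gamma (Complex p t) * Gamma (Complex q t)) \<le> norm (?C * inverse (1 + t\<^sup>2))" .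
  qed
qed

text \<open>The tilt \<open>exp (- d * y)\<close> makes \<open>loggamma_conv_cdf\<close> integrable:
  \<open>d > 0\<close> handles the right end, \<open>d < a\<close> and \<open>d < b\<close> the
  left. Divided by its mass it is a continuous probability density, to which Fourier inversion
  applies.\<close>

lemma loggamma_conv_cdf_eq_mellin_barnes:
  assumes "a > 0" "b > 0" "0 < d" "d < a" "d < b"
  defines "\<Phi> \<equiv> \<lambda>w. Gamma (of_real a - w) * Gamma (of_real b - w) / w"
  shows "complex_of_real (loggamma_conv_cdf a b v) =
    1 / (2 * pi) * (CLINT t|lborel. \<Phi> (Complex d t) * exp (Complex d t * of_real v))"
proof -
  \<comment> \<open>The mass of the tilted function, which is \<open>\<Phi>\<close> at
    \<open>d\<close>.\<close>
  define C where "C = Gamma (a - d) * Gamma (b - d) / d"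
  have C: "C > 0" using assms by (simp add: C_def Gamma_real_pos)
  define h where "h y = exp (- d * y) * loggamma_conv_cdf a b y / C" for y
  have h_of_real: "complex_of_real (h y) = exp (- of_real d * of_real y) * of_real (loggamma_conv_cdf a b y) / of_real C" for y
    by (simp add: h_def flip: exp_of_real)
  have Phi_d: "\<Phi> (of_real d) = of_real C"
    by (simp add: \<Phi>_def C_def Gamma_complex_of_real flip: of_real_diff)
  have "integrable lborel (\<lambda>y. complex_of_real (h y))"
    unfolding h_of_real using integrable_mellin_loggamma_conv_cdf[of a b "of_real d"] assms by simp
  then have int_h: "integrable lborel h"
    by (simp only: complex_of_real_integrable_eq)
  have "complex_of_real (LINT y|lborel. h y) = 1"
    unfolding integral_complex_of_real[symmetric] h_of_real
    using integral_mellin_loggamma_conv_cdf[of a b "of_real d"] assms Phi_d C by (simp add: \<Phi>_def)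
  then have total: "(LINT y|lborel. h y) = 1"
    using of_real_eq_1_iff by blast
  have nonneg: "h y \<ge> 0" for y
    using C by (simp add: h_def loggamma_conv_cdf_nonneg)
  have cont: "continuous_on UNIV h"
    unfolding h_def[abs_def] using C by (intro continuous_intros continuous_loggamma_conv_cdf assms) auto
  \<comment> \<open>\<open>exp (- d * y) * iexp (t * y)\<close> has exponent
    \<open>- (d - i t) * y\<close>, hence the sign of \<open>t\<close>; the reflection of
    \<open>t\<close> further down restores the upward direction.\<close>
  have char: "(CLINT y|lborel. h y * iexp (t * y)) = \<Phi> (Complex d (- t)) / C" for t
  proof -
    have "h y * iexp (t * y) = exp (- Complex d (- t) * of_real y) * of_real (loggamma_conv_cdf a b y) / C" for y
      unfolding h_of_real by (simp add: Complex_eq algebra_simps flip: exp_add)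
    then show ?thesis
      using integral_mellin_loggamma_conv_cdf[of a b "Complex d (- t)"] assms by (simp add: \<Phi>_def)
  qed
  have int_char: "integrable lborel (\<lambda>t. CLINT y|lborel. h y * iexp (t * y))"
    unfolding char
  proof (intro integrable_divide impI, rule Bochner_Integration.integrable_bound)
    show "integrable lborel (\<lambda>t. (1 / d) *\<^sub>R (Gamma (Complex (a - d) t) * Gamma (Complex (b - d) t)))"
      using assms by (intro integrable_scaleR_right integrable_Gamma_Gamma_vertical impI) auto
    have Phi_eq: "\<Phi> (Complex d (- t)) = Gamma (Complex (a - d) t) * Gamma (Complex (b - d) t) / Complex d (- t)" for t
    proof -
      have "of_real u - Complex d (- t) = Complex (u - d) t" for u by (simp add: complex_eq_iff)
      then show ?thesis by (simp add: \<Phi>_def)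
    qed
    have "continuous_on UNIV (\<lambda>t. Complex d (- t))" by (auto simp: Complex_eq intro!: continuous_intros)
    then have "(\<lambda>t. Complex d (- t)) \<in> borel_measurable lborel"
      by (simp add: borel_measurable_continuous_onI)
    then show "(\<lambda>t. \<Phi> (Complex d (- t))) \<in> borel_measurable lborel"
      unfolding Phi_eq
      using borel_measurable_integrable[OF integrable_Gamma_Gamma_vertical[of "a - d" "b - d"]] assms by simp
    \<comment> \<open>The Gamma product is already integrable, so the crude bound
      \<open>1 / d\<close> for the remaining factor suffices.\<close>
    have "norm (G / Complex d (- t)) \<le> norm ((1 / d) *\<^sub>R G)" for t and G :: complex
    proof -
      have "d \<le> norm (Complex d (- t))"
        using complex_Re_le_cmod[of "Complex d (- t)"] by simp
      then have "norm G / norm (Complex d (- t)) \<le> norm G / d"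
        using \<open>0 < d\<close> by (intro divide_left_mono mult_pos_pos) auto
      then show ?thesis
        using \<open>0 < d\<close> by (simp only: norm_divide norm_scaleR) simp
    qed
    then show "AE t in lborel. norm (\<Phi> (Complex d (- t))) \<le>
        norm ((1 / d) *\<^sub>R (Gamma (Complex (a - d) t) * Gamma (Complex (b - d) t)))"
      unfolding Phi_eq by (intro AE_I2)
  qed
  have "complex_of_real (h v) = 1 / (2 * pi) * (CLINT t|lborel. iexp (- (t * v)) * (\<Phi> (Complex d (- t)) / C))"
    using density_eq_inverse_char[OF int_h nonneg cont total int_char] by (simp only: char)
  also have "(CLINT t|lborel. iexp (- (t * v)) * (\<Phi> (Complex d (- t)) / C)) =
      (CLINT t|lborel. iexp (t * v) * (\<Phi> (Complex d t) / C))"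
    using lborel_integral_real_affine[of "-1" "\<lambda>t. iexp (t * v) * (\<Phi> (Complex d t) / C)" 0] by auto
  \<comment> \<open>Multiplying by \<open>C * exp (d * v)\<close> undoes both the normalisation and
    the tilt.\<close>
  finally have "complex_of_real (h v) * C * exp (of_real (d * v)) =
      1 / (2 * pi) * ((CLINT t|lborel. iexp (t * v) * (\<Phi> (Complex d t) / C)) * C * exp (of_real (d * v)))"
    by simp
  also have "(CLINT t|lborel. iexp (t * v) * (\<Phi> (Complex d t) / C)) * C * exp (of_real (d * v)) =
      (CLINT t|lborel. iexp (t * v) * (\<Phi> (Complex d t) / C) * C * exp (of_real (d * v)))"
    by (simp only: integral_mult_left_zero)
  also have "\<dots> = (CLINT t|lborel. \<Phi> (Complex d t) * exp (Complex d t * of_real v))"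
    using C by (intro Bochner_Integration.integral_cong refl) (simp add: Complex_eq algebra_simps flip: exp_add)
  also have "complex_of_real (h v) * C * exp (of_real (d * v)) = of_real (loggamma_conv_cdf a b v)"
    using C by (simp add: h_def flip: exp_of_real exp_add)
  finally show ?thesis .
qed

subsection \<open>The Meijer G-function\<close>

lemma meijer_integrand_2_1:
  "meijer_integrand 2 1 [a1] [b1, b2, b3] x s =
    Gamma (b1 - s) * Gamma (b2 - s) * Gamma (1 - a1 + s) / Gamma (1 - b3 + s) * complex_of_real x powr s"
proof -
  have "{2..<length [b1, b2, b3]} = {2}" by auto
  then show ?thesis
    by (simp add: meijer_integrand_def numeral_2_eq_2 lessThan_Suc mult_ac)
qed

text \<open>Every separating line yields the same value, because the inversion formula holds for
  every admissible \<open>d\<close>. This makes the description operator in \<open>meijer_G\<close>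
  well defined without moving contours.\<close>

lemma meijer_G_eq_loggamma_conv_cdf:
  fixes \<alpha> \<zeta> x :: real
  assumes "\<alpha> > 0" "\<zeta> > 0" "x > 0"
  shows "meijer_G 2 1
         [1 - complex_of_real ((\<alpha> + \<zeta>) / 2)]
         [complex_of_real ((\<alpha> - \<zeta>) / 2), - complex_of_real ((\<alpha> - \<zeta>) / 2),
          - complex_of_real ((\<alpha> + \<zeta>) / 2)] x
    = of_real (x powr (- ((\<alpha> + \<zeta>) / 2)) * loggamma_conv_cdf \<alpha> \<zeta> (ln x))"
    (is "meijer_G 2 1 ?a ?b x = of_real ?W")
proof -
  let ?\<sigma> = "(\<alpha> + \<zeta>) / 2"
  let ?\<Phi> = "\<lambda>w. Gamma (of_real \<alpha> - w) * Gamma (of_real \<zeta> - w) / w"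
  have val: "of_real ?W = 1 / (2 * complex_of_real pi * \<i>) *
      (LINT t|lborel. meijer_integrand 2 1 ?a ?b x (Complex c t) * \<i>)"
    if "separating_line 2 1 ?a ?b c" for c
  proof -
    \<comment> \<open>The shift by \<open>\<sigma>\<close> carries the strip of separating lines to
      \<open>0 < d < min \<alpha> \<zeta>\<close>.\<close>
    define d where "d = c + ?\<sigma>"
    have c: "- ?\<sigma> < c" "c < - (\<bar>\<alpha> - \<zeta>\<bar> / 2)"
      using that separating_line_K_iff by auto
    have d: "0 < d" "d < \<alpha>" "d < \<zeta>"
      using c by (auto simp: d_def abs_if field_simps split: if_splits)
    have integrand: "meijer_integrand 2 1 ?a ?b x (Complex c t) =
        of_real (x powr (- ?\<sigma>)) * (?\<Phi> (Complex d t) * exp (Complex d t * of_real (ln x)))" for t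
    proof -
      define w where "w = Complex d t"
      have s: "Complex c t = w - of_real ?\<sigma>"
        by (simp add: w_def d_def complex_eq_iff)
      have wn: "w \<notin> \<int>\<^sub>\<le>\<^sub>0"
        using d by (auto simp: w_def complex_eq_iff elim!: nonpos_Ints_cases)
      have G: "of_real ((\<alpha> - \<zeta>) / 2) - (w - of_real ?\<sigma>) = of_real \<alpha> - w"
        "- of_real ((\<alpha> - \<zeta>) / 2) - (w - of_real ?\<sigma>) = of_real \<zeta> - w"
        "1 - (1 - of_real ?\<sigma>) + (w - of_real ?\<sigma>) = w"
        "1 - (- of_real ?\<sigma>) + (w - of_real ?\<sigma>) = w + 1"
        by (auto simp: complex_eq_iff field_simps)
      have powr: "complex_of_real x powr (w - of_real ?\<sigma>) = of_real (x powr (- ?\<sigma>)) * exp (w * of_real (ln x))"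
        using assms
        by (simp add: powr_def Ln_of_real algebra_simps flip: exp_of_real exp_add)
      have "meijer_integrand 2 1 ?a ?b x (Complex c t) =
          Gamma (of_real \<alpha> - w) * Gamma (of_real \<zeta> - w) * Gamma w / Gamma (w + 1) *
          (of_real (x powr (- ?\<sigma>)) * exp (w * of_real (ln x)))"
        unfolding meijer_integrand_2_1 s G powr ..
      also have "Gamma (of_real \<alpha> - w) * Gamma (of_real \<zeta> - w) * Gamma w / Gamma (w + 1) = ?\<Phi> w"
        using wn by (simp add: Gamma_plus1 Gamma_eq_zero_iff)
      finally show ?thesis by (simp add: w_def)
    qed
    have "1 / (2 * complex_of_real pi * \<i>) * (LINT t|lborel. meijer_integrand 2 1 ?a ?b x (Complex c t) * \<i>) =
        of_real (x powr (- ?\<sigma>)) *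
        (1 / (2 * pi) * (CLINT t|lborel. ?\<Phi> (Complex d t) * exp (Complex d t * of_real (ln x))))"
      unfolding integrand integral_mult_left_zero integral_mult_right_zero by simp
    also have "\<dots> = of_real ?W"
      using loggamma_conv_cdf_eq_mellin_barnes[of \<alpha> \<zeta> d "ln x"] assms d by simp
    finally show ?thesis ..
  qed
  \<comment> \<open>The midpoint of the admissible interval. Without some separating line the
    defining condition would be vacuous and uniqueness would fail.\<close>
  have ex: "separating_line 2 1 ?a ?b ((- ?\<sigma> - \<bar>\<alpha> - \<zeta>\<bar> / 2) / 2)"
    unfolding separating_line_K_iff using assms by (auto simp: abs_if field_simps)
  show ?thesis
    unfolding meijer_G_def
  proof (rule the_equality)
    fix w assume "\<forall>c. separating_line 2 1 ?a ?b c \<longrightarrow> w = 1 / (2 * complex_of_real pi * \<i>) *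
      (LINT t|lborel. meijer_integrand 2 1 ?a ?b x (Complex c t) * \<i>)"
    with ex val[OF ex] show "w = of_real ?W" by simp
  qed (use val in blast)
qed

subsection \<open>The symmetric K-distribution\<close>

lemma bessel_K_measurable [measurable]: "bessel_K \<nu> \<in> borel_measurable borel"
  unfolding bessel_K_def[abs_def] set_lebesgue_integral_def
  by (rule lborel.borel_measurable_lebesgue_integral) (unfold cosh_def, measurable)

lemma K_dist_pdf_measurable [measurable]: "K_dist_pdf \<alpha> \<zeta> \<delta> \<gamma> \<in> borel_measurable borel"
  unfolding K_dist_pdf_def[abs_def] by measurable

context
  fixes \<alpha> \<zeta> \<delta> :: real
  assumes pos: "\<alpha> > 0" "\<zeta> > 0" "\<delta> > 0"
begin

text \<open>In the logarithmic variable the scale \<open>\<delta>\<close> becomes a translation by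
  \<open>ln \<delta>\<close>. The left factor \<open>exp y\<close> is the Jacobian, and the 2 in the
  denominator comes from \<open>loggamma_conv_eq_bessel_K\<close>.\<close>

lemma K_dist_pdf_exp:
  "exp y * K_dist_pdf \<alpha> \<zeta> \<delta> 0 (exp y) = loggamma_conv \<alpha> \<zeta> (ln \<delta> + y) / (2 * Gamma \<alpha> * Gamma \<zeta>)"
proof -
  have sqrt: "sqrt (\<delta> * exp y) = exp ((ln \<delta> + y) / 2)"
  proof -
    have "sqrt ((exp ((ln \<delta> + y) / 2))\<^sup>2) = exp ((ln \<delta> + y) / 2)" by simp
    also have "(exp ((ln \<delta> + y) / 2))\<^sup>2 = \<delta> * exp y"
      using pos by (simp add: exp_add add_divide_distrib power_mult_distrib flip: exp_double)
    finally show ?thesis .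
  qed
  have "\<delta> powr ((\<alpha> + \<zeta>) / 2) * (exp y * exp y powr ((\<alpha> + \<zeta>) / 2 - 1)) = exp ((\<alpha> + \<zeta>) / 2 * (ln \<delta> + y))"
    using pos by (simp add: powr_def flip: exp_add) (simp add: field_simps)
  then show ?thesis
    unfolding K_dist_pdf_def loggamma_conv_eq_bessel_K[OF pos(1,2)] by (simp add: sqrt mult_ac)
qed

text \<open>All three parts use \<open>u = exp y\<close> and then the translation by
  \<open>ln \<delta>\<close>, which sends the bound \<open>T\<close> to
  \<open>ln (\<delta> * T)\<close>. The value \<open>1 / 2\<close> is the mass
  \<open>Gamma \<alpha> * Gamma \<zeta>\<close> over the constant of
  \<open>K_dist_pdf_exp\<close>.\<close>

lemma set_integral_K_dist_pdf:
  shows set_integrable_K_dist_pdf: "set_integrable lborel {0<..} (K_dist_pdf \<alpha> \<zeta> \<delta> 0)"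
    and set_integral_K_dist_pdf_total: "(LINT u:{0<..}|lborel. K_dist_pdf \<alpha> \<zeta> \<delta> 0 u) = 1 / 2"
    and set_integral_K_dist_pdf_less: "T > 0 \<Longrightarrow> (LINT u:{0<..<T}|lborel. K_dist_pdf \<alpha> \<zeta> \<delta> 0 u) =
        loggamma_conv_cdf \<alpha> \<zeta> (ln (\<delta> * T)) / (2 * Gamma \<alpha> * Gamma \<zeta>)"
proof -
  let ?q = "K_dist_pdf \<alpha> \<zeta> \<delta> 0"
  let ?C = "2 * Gamma \<alpha> * Gamma \<zeta>"
  have Gamma_nz: "Gamma \<alpha> \<noteq> 0" "Gamma \<zeta> \<noteq> 0"
    using pos Gamma_real_pos by (metis less_irrefl)+
  have shift: "(LINT y|lborel. g (ln \<delta> + y)) = (LINT y|lborel. g y)" for g :: "real \<Rightarrow> real"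
    using lborel_integral_real_affine[of 1 g "ln \<delta>"] by simp
  have "integrable lborel (\<lambda>y. loggamma_conv \<alpha> \<zeta> (ln \<delta> + y))"
    using lborel_integrable_real_affine[OF integrable_loggamma_conv[OF pos(1,2)], of 1 "ln \<delta>"] by simp
  then show "set_integrable lborel {0<..} ?q"
    by (subst set_integrable_exp_substitution_iff) (simp_all add: K_dist_pdf_exp)
  show "(LINT u:{0<..}|lborel. ?q u) = 1 / 2"
    using Gamma_nz by (subst set_integral_exp_substitution)
      (simp_all add: K_dist_pdf_exp shift integral_loggamma_conv pos)
  show "(LINT u:{0<..<T}|lborel. ?q u) = loggamma_conv_cdf \<alpha> \<zeta> (ln (\<delta> * T)) / ?C" if T: "T > 0"
  proof -
    have exp_less: "exp y < T \<longleftrightarrow> y < ln T" for y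
      using T by (metis exp_less_cancel_iff exp_ln)
    have "(LINT u:{0<..<T}|lborel. ?q u) = (LINT u:{0<..}|lborel. indicator {..<T} u * ?q u)"
      unfolding set_lebesgue_integral_def
      by (intro Bochner_Integration.integral_cong) (auto simp: indicator_def)
    also have "\<dots> = (LINT y|lborel. indicator {..<T} (exp y) * (exp y * ?q (exp y)))"
      by (subst set_integral_exp_substitution) (simp_all add: mult_ac)
    also have "\<dots> = (LINT y|lborel. indicator {..<ln (\<delta> * T)} (ln \<delta> + y) * loggamma_conv \<alpha> \<zeta> (ln \<delta> + y) / ?C)"
      unfolding K_dist_pdf_exp using pos T
      by (intro Bochner_Integration.integral_cong) (auto simp: indicator_def ln_mult exp_less)
    also have "\<dots> = (LINT y|lborel. indicator {..<ln (\<delta> * T)} y * loggamma_conv \<alpha> \<zeta> y / ?C)"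
      by (rule shift)
    also have "\<dots> = loggamma_conv_cdf \<alpha> \<zeta> (ln (\<delta> * T)) / ?C"
      by (simp add: loggamma_conv_cdf_def set_lebesgue_integral_def)
    finally show ?thesis .
  qed
qed

text \<open>Off 0 the even density is the sum of its restriction to the positive half line and the
  reflection of that restriction.\<close>

lemma integrable_K_dist_pdf: "integrable lborel (K_dist_pdf \<alpha> \<zeta> \<delta> 0)"
proof -
  let ?q = "K_dist_pdf \<alpha> \<zeta> \<delta> 0"
  let ?p = "\<lambda>u. indicator {0<..} u *\<^sub>R ?q u"
  have even: "?q (- u) = ?q u" for u by (simp add: K_dist_pdf_def)
  have p: "integrable lborel ?p"
    using set_integrable_K_dist_pdf by (simp add: set_integrable_def)
  have "integrable lborel (\<lambda>u. ?p u + ?p (- u))"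
    using p lborel_integrable_real_affine[OF p, of "-1" 0] by simp
  moreover have "AE u in lborel. ?p u + ?p (- u) = ?q u"
    using AE_lborel_singleton[of 0] by eventually_elim (auto simp: indicator_def even)
  ultimately show ?thesis
    by (subst integrable_cong_AE[symmetric]) auto
qed

lemma K_dist_cdf_eq:
  "K_dist_cdf \<alpha> \<zeta> \<delta> \<gamma> x =
    1 / 2 + sgn_right (x - \<gamma>) * (LINT u:{0<..<\<bar>x - \<gamma>\<bar>}|lborel. K_dist_pdf \<alpha> \<zeta> \<delta> 0 u)"
proof -
  have "K_dist_cdf \<alpha> \<zeta> \<delta> \<gamma> x = (LINT s:{..x - \<gamma>}|lborel. K_dist_pdf \<alpha> \<zeta> \<delta> 0 s)"
    unfolding K_dist_cdf_def set_lebesgue_integral_def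
    by (subst lborel_integral_real_affine[of 1 _ \<gamma>])
      (auto simp: indicator_def K_dist_pdf_def intro!: Bochner_Integration.integral_cong)
  also have "\<dots> = (LINT s:{0<..}|lborel. K_dist_pdf \<alpha> \<zeta> \<delta> 0 s) +
      sgn_right (x - \<gamma>) * (LINT u:{0<..<\<bar>x - \<gamma>\<bar>}|lborel. K_dist_pdf \<alpha> \<zeta> \<delta> 0 u)"
    by (intro set_integral_even_atMost integrable_K_dist_pdf) (simp add: K_dist_pdf_def)
  finally show ?thesis by (simp add: set_integral_K_dist_pdf_total)
qed

end

theorem mainTheorem2:
  fixes \<alpha> \<zeta> \<delta> \<gamma> x :: real
  assumes "\<alpha> > 0" and "\<zeta> > 0" and "\<delta> > 0"
  shows "complex_of_real (K_dist_cdf \<alpha> \<zeta> \<delta> \<gamma> x) =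
    1 / 2 +
    (if x = \<gamma> then 0 else
       complex_of_real
         (sgn_right (x - \<gamma>) * \<delta> powr ((\<alpha> + \<zeta>) / 2) / (2 * Gamma \<alpha> * Gamma \<zeta>) *
          \<bar>x - \<gamma>\<bar> powr ((\<alpha> + \<zeta>) / 2)) *
       meijer_G 2 1
         [1 - complex_of_real ((\<alpha> + \<zeta>) / 2)]
         [complex_of_real ((\<alpha> - \<zeta>) / 2), - complex_of_real ((\<alpha> - \<zeta>) / 2),
          - complex_of_real ((\<alpha> + \<zeta>) / 2)]
         (\<delta> * \<bar>x - \<gamma>\<bar>))"
proof (cases "x = \<gamma>")
  case True
  \<comment> \<open>The correction term is an integral over the empty interval.\<close>
  then have half: "K_dist_cdf \<alpha> \<zeta> \<delta> \<gamma> x = 1 / 2"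
    using K_dist_cdf_eq[OF assms, of \<gamma> x] by (simp add: set_lebesgue_integral_def)
  show ?thesis
    unfolding half using True by simp
next
  case False
  let ?T = "\<bar>x - \<gamma>\<bar>" and ?\<sigma> = "(\<alpha> + \<zeta>) / 2"
  let ?H = "loggamma_conv_cdf \<alpha> \<zeta> (ln (\<delta> * ?T))"
  have T: "?T > 0" "\<delta> * ?T > 0" using False assms by auto
  \<comment> \<open>The power prefactor of the theorem cancels the one produced by the shift of
    \<open>s\<close> in the G-function.\<close>
  have "\<delta> powr ?\<sigma> * ?T powr ?\<sigma> * (\<delta> * ?T) powr (- ?\<sigma>) = 1"
    using T assms by (simp add: powr_minus flip: powr_mult)
  then have cancel: "sgn_right (x - \<gamma>) * (?H / (2 * Gamma \<alpha> * Gamma \<zeta>)) =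
      sgn_right (x - \<gamma>) * \<delta> powr ?\<sigma> / (2 * Gamma \<alpha> * Gamma \<zeta>) * ?T powr ?\<sigma> *
      ((\<delta> * ?T) powr (- ?\<sigma>) * ?H)"
    by (simp add: mult_ac)
  have "K_dist_cdf \<alpha> \<zeta> \<delta> \<gamma> x = 1 / 2 + sgn_right (x - \<gamma>) * (?H / (2 * Gamma \<alpha> * Gamma \<zeta>))"
    unfolding K_dist_cdf_eq[OF assms] set_integral_K_dist_pdf_less[OF assms T(1)] ..
  then show ?thesis
    unfolding meijer_G_eq_loggamma_conv_cdf[OF assms(1,2) T(2)] cancel
    using False by simp
qed

end
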